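(* Let $G$ be a finite simple graph that is bull-free and $4K_1$-free. Then $G$ is perfectly weight divisible, and hence $G$ is perfectly divisible.
   Context: A bull is a triangle with two disjoint pendant edges. $4K_1$ is the edgeless graph on $4$ vertices (so $4K_1$-free means no stable set of size $4$). $G$ is $H$-free if no induced subgraph is isomorphic to $H$. A graph is perfect if $\chi(H)=\omega(H)$ for every induced subgraph $H$. $G$ is perfectly divisible if for every induced subgraph $H$ of $G$, $V(H)$ can be partitioned into $A,B$ with $H[A]$ perfect and $\omega(H[B])<\omega(H)$. For a weight function $w$, $\omega_w$ denotes the maximum weight of a clique. $G$ is perfectly weight divisible if for every positive integer weight function $w$ on $V(G)$ and every induced subgraph $H$ of $G$, there is a partition of $V(H)$ into $P,W$ with $H[P]$ perfect and $\omega_w(H[W])<\omega_w(H)$. *)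

theory Defs
  imports "Graph_Theory.Digraph_Isomorphism"
begin

text \<open>
  A finite simple graph is a digraph satisfying the locale \<^locale>\<open>graph\<close>: finite, loop-free,
  without parallel arcs, and symmetric, so that an undirected edge is a pair of opposite arcs.
  The null graph is a graph.
\<close>

definition free_of :: "('c, 'd) pre_digraph \<Rightarrow> ('a, 'b) pre_digraph \<Rightarrow> bool" where
  "free_of F G \<longleftrightarrow> \<not> (\<exists>H. induced_subgraph H G \<and> digraph_iso H F)"

text \<open>The triangle on 0, 1, 2 with the pendant edges 0--3 and 1--4.\<close>

definition bull :: "(nat, nat \<times> nat) pre_digraph" where
  "bull = (let E = {(0, 1), (1, 2), (0, 2), (0, 3), (1, 4)} in
     \<lparr>verts = {0, 1, 2, 3, 4}, arcs = E \<union> E\<inverse>, tail = fst, head = snd\<rparr>)"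

definition edgeless :: "nat \<Rightarrow> (nat, nat \<times> nat) pre_digraph" where
  "edgeless n = \<lparr>verts = {..<n}, arcs = {}, tail = fst, head = snd\<rparr>"

lemma graph_bull: "graph bull"
  by unfold_locales (auto simp: bull_def arc_to_ends_def symmetric_def arcs_ends_conv sym_def)

lemma graph_edgeless: "graph (edgeless n)"
  by unfold_locales (auto simp: edgeless_def symmetric_conv)

definition is_clique :: "('a, 'b) pre_digraph \<Rightarrow> 'a set \<Rightarrow> bool" where
  "is_clique G K \<longleftrightarrow> K \<subseteq> verts G \<and> (\<forall>u\<in>K. \<forall>v\<in>K. u \<noteq> v \<longrightarrow> u \<rightarrow>\<^bsub>G\<^esub> v)"

text \<open>The empty set is a clique, so both clique numbers of the null graph are 0.\<close>

definition clique_number :: "('a, 'b) pre_digraph \<Rightarrow> nat" where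
  "clique_number G = Max (card ` {K. is_clique G K})"

definition weighted_clique_number :: "('a \<Rightarrow> nat) \<Rightarrow> ('a, 'b) pre_digraph \<Rightarrow> nat" where
  "weighted_clique_number w G = Max (sum w ` {K. is_clique G K})"

definition proper_coloring :: "('a, 'b) pre_digraph \<Rightarrow> nat \<Rightarrow> ('a \<Rightarrow> nat) \<Rightarrow> bool" where
  "proper_coloring G k c \<longleftrightarrow>
     c ` verts G \<subseteq> {..<k} \<and> (\<forall>u\<in>verts G. \<forall>v\<in>verts G. u \<rightarrow>\<^bsub>G\<^esub> v \<longrightarrow> c u \<noteq> c v)"

definition chromatic_number :: "('a, 'b) pre_digraph \<Rightarrow> nat" where
  "chromatic_number G = (LEAST k. \<exists>c. proper_coloring G k c)"

definition perfect_graph :: "('a, 'b) pre_digraph \<Rightarrow> bool" where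
  "perfect_graph G \<longleftrightarrow> (\<forall>H. induced_subgraph H G \<longrightarrow> chromatic_number H = clique_number H)"

text \<open>
  In both notions of divisibility the induced subgraph must have a vertex: the clique numbers of
  the null graph are 0, so no part of it could have a smaller one.  The parts may be empty.
\<close>

definition perfectly_divisible :: "('a, 'b) pre_digraph \<Rightarrow> bool" where
  "perfectly_divisible G \<longleftrightarrow>
     (\<forall>H. induced_subgraph H G \<and> verts H \<noteq> {} \<longrightarrow>
        (\<exists>A B. A \<union> B = verts H \<and> A \<inter> B = {} \<and>
           perfect_graph (H \<restriction> A) \<and> clique_number (H \<restriction> B) < clique_number H))"

definition perfectly_weight_divisible :: "('a, 'b) pre_digraph \<Rightarrow> bool" where
  "perfectly_weight_divisible G \<longleftrightarrow>
     (\<forall>w :: 'a \<Rightarrow> nat. (\<forall>v\<in>verts G. 0 < w v) \<longrightarrow>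
        (\<forall>H. induced_subgraph H G \<and> verts H \<noteq> {} \<longrightarrow>
           (\<exists>P W. P \<union> W = verts H \<and> P \<inter> W = {} \<and> perfect_graph (H \<restriction> P) \<and>
              weighted_clique_number w (H \<restriction> W) < weighted_clique_number w H)))"

end

theory Submission
  imports Defs
begin

text \<open>
  In the complement, which is bull-free and \<open>K\<^sub>4\<close>-free, some vertex \<open>u\<close> has a bipartite
  neighbourhood.  Otherwise a vertex \<open>v\<close> has an induced odd cycle \<open>C\<close> of length at least 5 in its
  neighbourhood.  For each \<open>c\<close> on \<open>C\<close>, the common neighbours of \<open>v\<close> and \<open>c\<close> form a stable set, so
  \<open>c\<close> lies in a triangle whose other two vertices are not adjacent to \<open>v\<close>.  If \<open>C\<close> has length at
  least 7, bull-freeness forces these two vertices to be adjacent to the next vertex of \<open>C\<close> as well,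
  which gives a \<open>K\<^sub>4\<close>; if \<open>C\<close> has length 5, the triangles at two consecutive vertices of \<open>C\<close>
  produce a bull.

  Back in the graph, the non-neighbours of \<open>u\<close> are covered by two disjoint cliques, so together with
  the isolated vertex \<open>u\<close> they induce a perfect graph, by Koenig's theorem.  Every clique among the
  neighbours of \<open>u\<close> extends by \<open>u\<close>, so it does not have maximum weight.
\<close>

section \<open>Bipartite neighbourhoods\<close>

definition bipartite_on :: "('a \<Rightarrow> 'a \<Rightarrow> bool) \<Rightarrow> 'a set \<Rightarrow> bool" where
  "bipartite_on E S \<longleftrightarrow> (\<exists>A\<subseteq>S. (\<forall>x\<in>A. \<forall>y\<in>A. \<not> E x y) \<and> (\<forall>x\<in>S - A. \<forall>y\<in>S - A. \<not> E x y))"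

text \<open>Without odd closed walks, the parity of a walk from a fixed root of the component is
  determined by its endpoint and changes along every edge. Splitting \<open>S\<close> by this parity
  leaves two stable sets.\<close>

lemma not_bipartite_imp_odd_closed_walk:
  assumes "sym R"
    and nb: "\<not> bipartite_on (\<lambda>x y. (x, y) \<in> R) S"
  shows "\<exists>x n. odd n \<and> (x, x) \<in> R ^^ n"
proof (rule ccontr)
  assume no_odd: "\<nexists>x n. odd n \<and> (x, x) \<in> R ^^ n"
  have flip: "(y, x) \<in> R ^^ n" if "(x, y) \<in> R ^^ n" for x y n
    using that
  proof (induction n arbitrary: y)
    case (Suc n)
    then show ?case using \<open>sym R\<close>
      by (auto elim!: relpow_Suc_E dest: symD intro!: relpow_Suc_I2 simp del: relpow.simps)
  qed simp
  \<comment> \<open>The choice depends on \<open>x\<close> only through the set of vertices that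
    reach \<open>x\<close>, so it is constant on each component; this is what \<open>root_eq\<close>
    exploits.\<close>
  define root where "root x = (SOME r. (r, x) \<in> R\<^sup>*)" for x
  have root: "(root x, x) \<in> R\<^sup>*" for x
    unfolding root_def by (rule someI[of _ x]) simp
  have root_eq: "root x = root y" if "(x, y) \<in> R" for x y
  proof -
    have "(r, x) \<in> R\<^sup>* \<longleftrightarrow> (r, y) \<in> R\<^sup>*" for r
      using that \<open>sym R\<close> by (meson rtrancl.rtrancl_into_rtrancl symD)
    then show ?thesis by (simp add: root_def)
  qed
  define A where "A = {x\<in>S. \<exists>n. even n \<and> (root x, x) \<in> R ^^ n}"
  have parity: False
    if "(x, y) \<in> R" "(root x, x) \<in> R ^^ m" "(root y, y) \<in> R ^^ n" "even m \<longleftrightarrow> even n" for x y m n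
  proof -
    have "(root x, y) \<in> R ^^ Suc m" using that by auto
    moreover have "(y, root x) \<in> R ^^ n" using that root_eq flip by metis
    ultimately have "(root x, root x) \<in> R ^^ (Suc m + n)"
      by (meson relpow_trans)
    then show False using no_odd that(4) by (metis even_Suc even_add plus_nat.simps(2))
  qed
  have "A \<subseteq> S" by (auto simp: A_def)
  moreover have "\<forall>x\<in>A. \<forall>y\<in>A. (x, y) \<notin> R"
    using parity unfolding A_def by blast
  moreover have "\<forall>x\<in>S - A. \<forall>y\<in>S - A. (x, y) \<notin> R"
  proof -
    have "\<exists>n. odd n \<and> (root x, x) \<in> R ^^ n" if "x \<in> S - A" for x
      using that root[of x] by (auto simp: A_def rtrancl_power)
    then show ?thesis using parity by meson
  qed
  ultimately show False using nb by (auto simp: bipartite_on_def)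
qed

text \<open>With \<open>d = j - i\<close>, a chord cuts the walk into closed walks of lengths
  \<open>d + 1\<close> and \<open>n - d + 1\<close>. These add up to the odd number
  \<open>n + 2\<close>, so one of them is odd, and both are below \<open>n\<close> since
  \<open>2 \<le> d \<le> n - 2\<close>. The last condition in \<open>ij\<close> excludes the pair
  \<open>0\<close>, \<open>n - 1\<close>, which is the closing edge.\<close>

lemma shortest_odd_closed_walk_chordless:
  assumes "sym R" "odd n"
    and walk: "\<And>i. i < n \<Longrightarrow> (f i, f (Suc i)) \<in> R" and closed: "f n = f 0"
    and shortest: "\<And>m x. odd m \<Longrightarrow> (x, x) \<in> R ^^ m \<Longrightarrow> n \<le> m"
    and ij: "Suc i < j" "j < n" "i \<noteq> 0 \<or> Suc j < n"
  shows "(f i, f j) \<notin> R"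
proof
  assume chord: "(f i, f j) \<in> R"
  have seg: "(f a, f (a + k)) \<in> R ^^ k" if "a + k \<le> n" for a k
    using that by (induction k) (auto intro!: relpow_Suc_I walk)
  define d where "d = j - i"
  have d: "j = i + d" "2 \<le> d" "d + 2 \<le> n" using ij by (auto simp: d_def)
  have "(f i, f j) \<in> R ^^ d" using seg[of i d] d ij by simp
  then have "(f i, f i) \<in> R ^^ Suc d"
    using chord \<open>sym R\<close> by (auto dest: symD)
  moreover have "(f i, f i) \<in> R ^^ Suc (n - d)"
  proof -
    have "(f j, f n) \<in> R ^^ (n - j)" using seg[of j "n - j"] ij by simp
    moreover have "(f 0, f i) \<in> R ^^ i" using seg[of 0 i] ij by simp
    ultimately have "(f j, f i) \<in> R ^^ (n - j + i)" using closed by (metis relpow_trans)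
    moreover have "n - j + i = n - d" using d ij by simp
    ultimately show ?thesis using chord by (metis relpow_Suc_I2)
  qed
  ultimately show False
    using shortest[of "Suc d" "f i"] shortest[of "Suc (n - d)" "f i"] d(2,3) \<open>odd n\<close>
    by (cases "even d") simp_all
qed

section \<open>Relations without bull and \<open>K4\<close>\<close>

text \<open>In \<open>no_bull\<close> the triangle is \<open>a b c\<close>, with \<open>d\<close>
  pendant at \<open>a\<close> and \<open>e\<close> pendant at \<open>b\<close>. Distinctness of the
  vertices is implied by the listed adjacencies together with \<open>sym\<close> and
  \<open>irrefl\<close>.\<close>

locale bull_K4_free =
  fixes E :: "'a \<Rightarrow> 'a \<Rightarrow> bool"
  assumes sym: "E x y \<Longrightarrow> E y x"
    and irrefl: "\<not> E x x"
    and no_K4: "\<not> (E a b \<and> E a c \<and> E a d \<and> E b c \<and> E b d \<and> E c d)"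
    and no_bull: "\<not> (E a b \<and> E b c \<and> E a c \<and> E a d \<and> E b e \<and>
      \<not> E a e \<and> \<not> E b d \<and> \<not> E c d \<and> \<not> E c e \<and> \<not> E d e)"
begin

lemma sym_iff: "E x y \<longleftrightarrow> E y x"
  using sym by blast

text \<open>The neighbours of \<open>c\<close> adjacent to \<open>v\<close> are stable, since there is no \<open>K\<^sub>4\<close>.\<close>

lemma neighbourhood_bipartite:
  assumes "E v c" and "\<And>x y. \<lbrakk>E c x; E c y; \<not> E v x; \<not> E v y; E x y\<rbrakk> \<Longrightarrow> False"
  shows "bipartite_on E {x. E c x}"
  unfolding bipartite_on_def
  using assms no_K4[of v c] by (intro exI[of _ "{x. E c x \<and> E v x}"]) blast

text \<open>If \<open>u\<close> misses \<open>c2\<close>, the triangle \<open>c1 v c2\<close> with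
  pendants \<open>u\<close> at \<open>c1\<close> and \<open>c4\<close>, \<open>c5\<close> or
  \<open>c6\<close> at \<open>v\<close> forces \<open>u\<close> to see all three. The triangle
  \<open>c4 u c5\<close> then forces \<open>u\<close> to see \<open>c3\<close>, and the triangle
  \<open>c3 u c4\<close> with pendants \<open>c2\<close> and \<open>c6\<close> is a bull.\<close>

lemma propagate_along_P6:
  assumes v: "E v c1" "E v c2" "E v c3" "E v c4" "E v c5" "E v c6"
    and P6: "E c1 c2" "E c2 c3" "E c3 c4" "E c4 c5" "E c5 c6"
      "\<not> E c1 c3" "\<not> E c1 c4" "\<not> E c1 c5" "\<not> E c1 c6" "\<not> E c2 c4" "\<not> E c2 c5" "\<not> E c2 c6"
      "\<not> E c3 c5" "\<not> E c3 c6" "\<not> E c4 c6"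
    and u: "\<not> E v u" "E u c1"
  shows "E u c2"
proof (rule ccontr)
  assume "\<not> E u c2"
  then have "E u c4" "E u c5" "E u c6"
    using no_bull[of c1 v c2 u c4] no_bull[of c1 v c2 u c5] no_bull[of c1 v c2 u c6] v P6 u by (auto simp: sym_iff)
  then show False
    using no_bull[of c4 u c5 c3 c1] no_bull[of c3 u c4 c2 c6] v P6 u \<open>\<not> E u c2\<close> by (auto simp: sym_iff)
qed

end

section \<open>Induced wheels with five spokes\<close>

text \<open>As a locale, the wheel can be reinterpreted along the symmetries of its rim, so each
  fact is proved at one rim vertex only.\<close>

locale wheel5 = bull_K4_free +
  fixes v c1 c2 c3 c4 c5
  assumes hub: "E v c1" "E v c2" "E v c3" "E v c4" "E v c5"
    and rim: "E c1 c2" "E c2 c3" "E c3 c4" "E c4 c5" "E c5 c1"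
      "\<not> E c1 c3" "\<not> E c2 c4" "\<not> E c3 c5" "\<not> E c4 c1" "\<not> E c5 c2"
begin

lemma reflect: "wheel5 E v c2 c1 c5 c4 c3"
  using hub rim by unfold_locales (auto simp: sym_iff)

text \<open>Otherwise the triangle \<open>c1 v c2\<close> has the pendants \<open>u\<close> at
  \<open>c1\<close> and \<open>c4\<close> at \<open>v\<close>; \<open>c4\<close> is the rim vertex
  opposite to the edge \<open>c1 c2\<close>.\<close>

lemma opposite_neighbour:
  assumes "\<not> E v u" "E u c1" "\<not> E u c2"
  shows "E u c4"
  using no_bull[of c1 v c2 u c4] hub rim assms by (simp add: sym_iff)

end

context wheel5
begin

lemma adjacent_rim_neighbour:
  assumes "\<not> E v u" "E u c1"
  shows "E u c2 \<or> E u c5"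
proof (rule ccontr)
  assume "\<not> ?thesis"
  then have "\<not> E u c2" "\<not> E u c5" by auto
  \<comment> \<open>The reflection of the rim that fixes \<open>c1\<close>. With it \<open>u\<close>
    sees both \<open>c3\<close> and \<open>c4\<close>, and the triangle \<open>c3 c4 u\<close> has
    the pendants \<open>c2\<close> and \<open>c5\<close>.\<close>
  interpret r: wheel5 E v c1 c5 c4 c3 c2
    using hub rim by unfold_locales (auto simp: sym_iff)
  have "E u c4" using opposite_neighbour assms \<open>\<not> E u c2\<close> .
  moreover have "E u c3" using r.opposite_neighbour assms \<open>\<not> E u c5\<close> .
  ultimately show False
    using no_bull[of c3 c4 u c2 c5] rim \<open>\<not> E u c2\<close> \<open>\<not> E u c5\<close> by (simp add: sym_iff)
qed

text \<open>Two adjacent vertices cannot both see both ends of a rim edge, as that would be a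
  \<open>K4\<close>. So neither \<open>c2\<close> nor \<open>c5\<close> is common to
  \<open>x\<close> and \<open>y\<close>, yet each vertex sees one of the two: they lean to opposite
  sides. Naming them by side removes the case distinction for later use.\<close>

lemma triangle_off_hub:
  assumes x: "\<not> E v x" "E x c1" and y: "\<not> E v y" "E y c1" and "E x y"
  obtains x' y' where "E x' y'" "\<not> E v x'" "\<not> E v y'"
    "E x' c1" "E x' c2" "E x' c3" "\<not> E x' c5"
    "E y' c1" "E y' c5" "E y' c4" "\<not> E y' c2" "\<not> (E x' c4 \<and> E y' c3)"
proof -
  interpret r: wheel5 E v c1 c5 c4 c3 c2
    using hub rim by unfold_locales (auto simp: sym_iff)
  have *: "\<not> (E x c \<and> E y c \<and> E x d \<and> E y d)" if "E c d" for c d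
    using no_K4[of x y c d] \<open>E x y\<close> that by blast
  have n: "\<not> (E x c2 \<and> E y c2)" "\<not> (E x c5 \<and> E y c5)" "\<not> (E x c3 \<and> E y c3 \<and> E x c4 \<and> E y c4)"
    using *[of c1 c2] *[of c5 c1] *[of c3 c4] x y rim by auto
  have c: "E x c2 \<or> E x c5" "E y c2 \<or> E y c5"
    using adjacent_rim_neighbour x y by auto
  have o: "E u c4" if "u = x \<or> u = y" "\<not> E u c2" for u
    using opposite_neighbour[of u] x y that by blast
  have o': "E u c3" if "u = x \<or> u = y" "\<not> E u c5" for u
    using r.opposite_neighbour[of u] x y that by blast
  show thesis
  proof (cases "E x c2")
    case True
    then show thesis using that[of x y] n c o[of y] o'[of x] x y \<open>E x y\<close> by blast
  next
    case False
    then show thesis using that[of y x] n c o[of x] o'[of y] x y sym[OF \<open>E x y\<close>] by blast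
  qed
qed

text \<open>Put both triangles in the normal form of \<open>triangle_off_hub\<close>, the second
  through \<open>reflect\<close>. Two bulls give \<open>y1\<close> the neighbour \<open>c3\<close>
  and \<open>y2\<close> the neighbour \<open>c5\<close>, so neither \<open>x1\<close> nor
  \<open>x2\<close> sees \<open>c4\<close>. Then the triangle \<open>c1 y1 x1\<close> with pendants
  \<open>x2\<close> and \<open>c4\<close> is a bull.\<close>

lemma no_two_triangles_off_hub:
  assumes x: "\<not> E v x" "E x c1" and y: "\<not> E v y" "E y c1" and "E x y"
    and p: "\<not> E v p" "E p c2" and q: "\<not> E v q" "E q c2" and "E p q"
  shows False
proof -
  interpret r: wheel5 E v c2 c1 c5 c4 c3 by (rule reflect)
  obtain x1 y1 where 1: "E x1 y1" "\<not> E v x1" "\<not> E v y1"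
    "E x1 c1" "E x1 c2" "E x1 c3" "\<not> E x1 c5"
    "E y1 c1" "E y1 c5" "E y1 c4" "\<not> E y1 c2" "\<not> (E x1 c4 \<and> E y1 c3)"
    using triangle_off_hub[OF x y \<open>E x y\<close>] .
  obtain x2 y2 where 2: "E x2 y2" "\<not> E v x2" "\<not> E v y2"
    "E x2 c2" "E x2 c1" "E x2 c5" "\<not> E x2 c3"
    "E y2 c2" "E y2 c3" "E y2 c4" "\<not> E y2 c1" "\<not> (E x2 c4 \<and> E y2 c5)"
    using r.triangle_off_hub[OF p q \<open>E p q\<close>] .
  have n: "\<not> E x1 x2" "\<not> E x1 y2" "\<not> E y1 x2"
    using no_K4[of x1 x2 c1 c2] no_K4[of x1 y2 c2 c3] no_K4[of y1 x2 c1 c5] 1 2 rim by (auto simp: sym_iff)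
  have "E y1 c3"
    using no_bull[of c1 x1 y1 x2 c3] 1 2 rim n by (simp add: sym_iff)
  moreover have "E y2 c5"
    using no_bull[of c2 x2 y2 x1 c5] 1 2 rim n by (simp add: sym_iff)
  ultimately have "\<not> E x1 c4" "\<not> E x2 c4" using 1 2 by auto
  then show False
    using no_bull[of c1 y1 x1 x2 c4] 1 2 rim n by (simp add: sym_iff)
qed

end

section \<open>Existence of a vertex with bipartite neighbourhood\<close>

context bull_K4_free
begin

text \<open>The clause \<open>u = v \<or> E v u\<close> ensures that \<open>u\<close> is a vertex of
  the graph when \<open>E\<close> is \<open>nonadjacent G\<close> and \<open>v\<close> is
  one.\<close>

lemma ex_bipartite_neighbourhood:
  "\<exists>u. (u = v \<or> E v u) \<and> bipartite_on E {x. E u x}"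
proof (cases "bipartite_on E {x. E v x}")
  case False
  define R where "R = {(x, y). E v x \<and> E v y \<and> E x y}"
  have "sym R" using sym by (auto simp: R_def sym_def)
  moreover have "\<not> bipartite_on (\<lambda>x y. (x, y) \<in> R) {x. E v x}"
    using False by (simp add: bipartite_on_def R_def Ball_def subset_iff cong: imp_cong conj_cong)
  ultimately have "\<exists>n x. odd n \<and> (x, x) \<in> R ^^ n"
    using not_bipartite_imp_odd_closed_walk by blast
  define n where "n = (LEAST n. \<exists>x. odd n \<and> (x, x) \<in> R ^^ n)"
  obtain x where n: "odd n" "(x, x) \<in> R ^^ n"
    using LeastI_ex[OF \<open>\<exists>n x. odd n \<and> (x, x) \<in> R ^^ n\<close>] unfolding n_def by blast
  have shortest: "n \<le> m" if "odd m" "(y, y) \<in> R ^^ m" for m y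
    unfolding n_def using that by (intro Least_le) blast
  obtain f where f: "f 0 = x" "f n = x" "\<And>i. i < n \<Longrightarrow> (f i, f (Suc i)) \<in> R"
    using n(2) unfolding relpow_fun_conv by blast
  have chordless: "\<not> E (f i) (f j)" if "Suc i < j" "j < n" "i \<noteq> 0 \<or> Suc j < n" for i j
  proof -
    have "(f i, f j) \<notin> R"
      using shortest_odd_closed_walk_chordless[OF \<open>sym R\<close> n(1), of f i j] f shortest that by simp
    moreover have "E v (f i)" "E v (f j)"
      using f(3)[of i] f(3)[of j] that by (auto simp: R_def)
    ultimately show ?thesis by (simp add: R_def)
  qed
  have hub: "E v (f i)" if "i < n" for i using f(3)[OF that] by (simp add: R_def)
  have step: "E (f i) (f (Suc i))" if "i < n" for i using f(3)[OF that] by (simp add: R_def)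
  \<comment> \<open>Length 1 would be a loop, and length 3 a triangle forming a \<open>K4\<close>
    with \<open>v\<close>.\<close>
  have "n \<noteq> 1" using f step[of 0] irrefl by auto
  moreover have "n \<noteq> 3"
  proof
    assume "n = 3"
    then have "E (f 0) (f 1)" "E (f 1) (f 2)" "E (f 2) (f 0)"
      using step[of 0] step[of 1] step[of 2] f by (auto simp: numeral_eq_Suc)
    then show False using no_K4[of v "f 0" "f 1" "f 2"] hub \<open>n = 3\<close> sym by simp
  qed
  ultimately have "n = 5 \<or> 7 \<le> n"
    using n(1) by presburger
  then show ?thesis
  proof
    assume "n = 5"
    interpret w: wheel5 E v "f 0" "f 1" "f 2" "f 3" "f 4"
      using hub[of 0] hub[of 1] hub[of 2] hub[of 3] hub[of 4]
        step[of 0] step[of 1] step[of 2] step[of 3] step[of 4] f(1,2)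
        chordless[of 0 2] chordless[of 1 3] chordless[of 2 4] chordless[of 0 3] chordless[of 1 4]
        \<open>n = 5\<close> sym_iff
      by unfold_locales (simp_all add: numeral_eq_Suc)
    \<comment> \<open>If both failed, \<open>f 0\<close> and \<open>f 1\<close> would each lie in a
      triangle whose other vertices are not adjacent to \<open>v\<close>.\<close>
    have "bipartite_on E {x. E (f 0) x} \<or> bipartite_on E {x. E (f 1) x}"
      using neighbourhood_bipartite[OF w.hub(1)] neighbourhood_bipartite[OF w.hub(2)]
        w.no_two_triangles_off_hub sym by metis
    then show ?thesis using w.hub by blast
  next
    assume "7 \<le> n"
    \<comment> \<open>The vertices \<open>f 0\<close> to \<open>f 5\<close> induce a path exactly
      because \<open>7 \<le> n\<close>: the pair \<open>0\<close>, \<open>5\<close> is then not the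
      closing edge.\<close>
    have up: "E u (f 1)" if "E (f 0) u" "\<not> E v u" for u
      by (rule propagate_along_P6[of v "f 0" "f 1" "f 2" "f 3" "f 4" "f 5"])
        (use that hub step[of 0] step[of 1] step[of 2] step[of 3] step[of 4] chordless \<open>7 \<le> n\<close> sym
          in \<open>simp_all add: numeral_eq_Suc\<close>)
    have "bipartite_on E {x. E (f 0) x}"
    proof (rule neighbourhood_bipartite)
      show "E v (f 0)" using hub \<open>7 \<le> n\<close> by simp
      show False if "E (f 0) x" "E (f 0) y" "\<not> E v x" "\<not> E v y" "E x y" for x y
        using no_K4[of "f 0" "f 1" x y] that up sym step[of 0] \<open>7 \<le> n\<close> by simp
    qed
    then show ?thesis using hub[of 0] \<open>7 \<le> n\<close> by auto
  qed
next
  case True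
  then show ?thesis by blast
qed

end

section \<open>Perfection\<close>

text \<open>Koenig's theorem for the bipartite complement: the colour classes are the edges of a
  maximum matching and the single uncovered vertices.\<close>

lemma cobipartite_colouring:
  fixes E :: "'a \<Rightarrow> 'a \<Rightarrow> bool"
  assumes "finite X" "finite Y" "X \<inter> Y = {}" and sym: "\<And>x y. E x y \<Longrightarrow> E y x"
    and "\<forall>x\<in>X. \<forall>x'\<in>X. x \<noteq> x' \<longrightarrow> E x x'" "\<forall>y\<in>Y. \<forall>y'\<in>Y. y \<noteq> y' \<longrightarrow> E y y'"
    and "\<And>K. \<lbrakk>K \<subseteq> X \<union> Y; \<forall>x\<in>K. \<forall>y\<in>K. x \<noteq> y \<longrightarrow> E x y\<rbrakk> \<Longrightarrow> card K \<le> k"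
  shows "\<exists>c :: 'a \<Rightarrow> nat. c ` (X \<union> Y) \<subseteq> {..<k} \<and>
    (\<forall>x\<in>X \<union> Y. \<forall>y\<in>X \<union> Y. x \<noteq> y \<longrightarrow> E x y \<longrightarrow> c x \<noteq> c y)"
  using assms(1-3,5-)
proof (induction "card (X \<union> Y)" arbitrary: X Y k rule: less_induct)
  case less
  define cl where "cl K \<longleftrightarrow> (\<forall>x\<in>K. \<forall>y\<in>K. x \<noteq> y \<longrightarrow> E x y)" for K
  have fin: "finite (X \<union> Y)" and disj: "X \<inter> Y = {}" using less.prems by auto
  have X: "E x x'" if "x \<in> X" "x' \<in> X" "x \<noteq> x'" for x x' using less.prems(4) that by blast
  have Y: "E y y'" if "y \<in> Y" "y' \<in> Y" "y \<noteq> y'" for y y' using less.prems(5) that by blast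
  have bound: "card K \<le> k" if "K \<subseteq> X \<union> Y" "cl K" for K
    using less.prems(6)[OF that(1)] that(2) unfolding cl_def by blast
  have IH: "\<exists>c :: 'a \<Rightarrow> nat. c ` (X' \<union> Y') \<subseteq> {..<l} \<and>
      (\<forall>x\<in>X' \<union> Y'. \<forall>y\<in>X' \<union> Y'. x \<noteq> y \<longrightarrow> E x y \<longrightarrow> c x \<noteq> c y)"
    if "X' \<subseteq> X" "Y' \<subseteq> Y" "X' \<union> Y' \<noteq> X \<union> Y"
      "\<And>K. \<lbrakk>K \<subseteq> X' \<union> Y'; cl K\<rbrakk> \<Longrightarrow> card K \<le> l" for X' Y' l
  proof (rule less.hyps)
    show "card (X' \<union> Y') < card (X \<union> Y)"
      using that(1-3) fin by (intro psubset_card_mono) auto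
    show "finite X'" "finite Y'" using that(1,2) fin finite_subset by auto
    show "X' \<inter> Y' = {}" using that(1,2) disj by blast
    show "\<forall>x\<in>X'. \<forall>x'\<in>X'. x \<noteq> x' \<longrightarrow> E x x'" "\<forall>y\<in>Y'. \<forall>y'\<in>Y'. y \<noteq> y' \<longrightarrow> E y y'"
      using that(1,2) X Y by (simp_all add: subset_iff)
    show "card K \<le> l" if "K \<subseteq> X' \<union> Y'" "\<forall>x\<in>K. \<forall>y\<in>K. x \<noteq> y \<longrightarrow> E x y" for K
      using \<open>\<And>K. \<lbrakk>K \<subseteq> X' \<union> Y'; cl K\<rbrakk> \<Longrightarrow> card K \<le> l\<close> that by (simp add: cl_def)
  qed
  show ?case
  proof (cases "cl (X \<union> Y)")
    \<comment> \<open>All vertices are pairwise adjacent, so any injective colouring will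
      do.\<close>
    case True
    then have "card (X \<union> Y) \<le> k" using bound by simp
    moreover obtain c where "bij_betw c (X \<union> Y) {0..<card (X \<union> Y)}"
      using ex_bij_betw_finite_nat[OF fin] by blast
    ultimately show ?thesis
      by (intro exI[of _ c]) (auto simp: bij_betw_def dest: inj_onD)
  next
    case False
    then obtain x y where xy: "x \<in> X" "y \<in> Y" "\<not> E x y" "\<not> E y x"
      using X Y sym unfolding cl_def by blast
    have "x \<noteq> y" using xy disj by blast
    show ?thesis
    proof (cases "\<exists>I \<subseteq> X \<union> Y - {x, y}. cl I \<and> card I = k")
      case False
      \<comment> \<open>Here every clique of size \<open>k\<close> meets \<open>{x, y}\<close>, so
        deleting both lowers the bound by one, and the nonadjacent \<open>x\<close>,
        \<open>y\<close> share the freed colour \<open>k - 1\<close>. The conjunct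
        \<open>0 < k\<close>, obtained from the empty clique, guards the truncated
        subtraction.\<close>
      have small: "card K \<le> k - 1 \<and> 0 < k" if "K \<subseteq> (X - {x}) \<union> (Y - {y})" "cl K" for K
      proof -
        have "K \<subseteq> X \<union> Y - {x, y}" using that disj xy by blast
        then have "card K \<noteq> k" using that False by blast
        moreover have "card K \<le> k" using bound that by blast
        ultimately show ?thesis by linarith
      qed
      then have "0 < k" using small[of "{}"] by (simp add: cl_def)
      obtain c :: "'a \<Rightarrow> nat" where c: "c ` ((X - {x}) \<union> (Y - {y})) \<subseteq> {..<k - 1}"
        "\<forall>u\<in>(X - {x}) \<union> (Y - {y}). \<forall>v\<in>(X - {x}) \<union> (Y - {y}). u \<noteq> v \<longrightarrow> E u v \<longrightarrow> c u \<noteq> c v"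
        using IH[of "X - {x}" "Y - {y}" "k - 1"] small xy disj by blast
      define d where "d = (\<lambda>u. if u = x \<or> u = y then k - 1 else c u)"
      have old: "d u = c u \<and> c u < k - 1 \<and> u \<in> (X - {x}) \<union> (Y - {y})"
        if "u \<in> X \<union> Y" "u \<noteq> x" "u \<noteq> y" for u
        using c(1) that by (auto simp: d_def)
      have new: "d x = k - 1" "d y = k - 1" by (auto simp: d_def)
      have "d u < k" if "u \<in> X \<union> Y" for u
        using old[OF that] new \<open>0 < k\<close> by (cases "u = x \<or> u = y") auto
      moreover have "d u \<noteq> d v" if "u \<in> X \<union> Y" "v \<in> X \<union> Y" "u \<noteq> v" "E u v" for u v
        using old[of u] old[of v] new c(2) that xy by (metis less_irrefl)
      ultimately show ?thesis by (intro exI[of _ d]) blast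
    next
      case True
      text \<open>A maximum clique avoiding \<open>x\<close> and \<open>y\<close> splits the graph into two smaller ones, whose
        clique numbers are the sizes of its two halves.\<close>
      then obtain I where I: "I \<subseteq> X \<union> Y - {x, y}" "cl I" "card I = k" by blast
      have finI: "finite I" using I fin finite_subset by blast
      have cardI: "card (I \<inter> X) + card (I \<inter> Y) = k"
      proof -
        have "I = (I \<inter> X) \<union> (I \<inter> Y)" using I(1) by blast
        then have "card I = card (I \<inter> X) + card (I \<inter> Y)"
          using finI disj by (metis card_Un_disjoint finite_Int Int_assoc Int_empty_right inf_left_commute)
        then show ?thesis using I(3) by simp
      qed
      \<comment> \<open>Adding \<open>I \<inter> Y\<close> to \<open>K\<close> keeps it a clique:
        the part of \<open>K\<close> inside \<open>I\<close> is joined to it within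
        \<open>I\<close>, the rest within \<open>Y\<close>. The bound \<open>k\<close> on the union
        leaves \<open>card (I \<inter> X)\<close> for \<open>K\<close>.\<close>
      have b1: "card K \<le> card (I \<inter> X)" if "K \<subseteq> (I \<inter> X) \<union> (Y - I)" "cl K" for K
      proof -
        have cross: "E u v" if "u \<in> K" "v \<in> I \<inter> Y" "u \<noteq> v" for u v
        proof (cases "u \<in> I")
          case True
          then show ?thesis using I(2) that unfolding cl_def by simp
        next
          case False
          then have "u \<in> Y" using \<open>u \<in> K\<close> \<open>K \<subseteq> _\<close> by blast
          then show ?thesis using Y that by simp
        qed
        have "cl (K \<union> (I \<inter> Y))"
          unfolding cl_def
        proof (intro ballI impI)
          fix u v assume "u \<in> K \<union> (I \<inter> Y)" "v \<in> K \<union> (I \<inter> Y)" "u \<noteq> v"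
          then show "E u v"
            using cross[of u v] sym[OF cross[of v u]] \<open>cl K\<close> Y unfolding cl_def by auto
        qed
        moreover have "K \<union> (I \<inter> Y) \<subseteq> X \<union> Y" using that by blast
        ultimately have "card (K \<union> (I \<inter> Y)) \<le> k" using bound by simp
        moreover have "card (K \<union> (I \<inter> Y)) = card K + card (I \<inter> Y)"
          using that fin disj finI by (intro card_Un_disjoint) (auto intro: finite_subset)
        ultimately show ?thesis using cardI by linarith
      qed
      have b2: "card K \<le> card (I \<inter> Y)" if "K \<subseteq> (X - I) \<union> (I \<inter> Y)" "cl K" for K
      proof -
        have cross: "E u v" if "u \<in> K" "v \<in> I \<inter> X" "u \<noteq> v" for u v
        proof (cases "u \<in> I")
          case True
          then show ?thesis using I(2) that unfolding cl_def by simp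
        next
          case False
          then have "u \<in> X" using \<open>u \<in> K\<close> \<open>K \<subseteq> _\<close> by blast
          then show ?thesis using X that by simp
        qed
        have "cl (K \<union> (I \<inter> X))"
          unfolding cl_def
        proof (intro ballI impI)
          fix u v assume "u \<in> K \<union> (I \<inter> X)" "v \<in> K \<union> (I \<inter> X)" "u \<noteq> v"
          then show "E u v"
            using cross[of u v] sym[OF cross[of v u]] \<open>cl K\<close> X unfolding cl_def by auto
        qed
        moreover have "K \<union> (I \<inter> X) \<subseteq> X \<union> Y" using that by blast
        ultimately have "card (K \<union> (I \<inter> X)) \<le> k" using bound by simp
        moreover have "card (K \<union> (I \<inter> X)) = card K + card (I \<inter> X)"
          using that fin disj finI by (intro card_Un_disjoint) (auto intro: finite_subset)
        ultimately show ?thesis using cardI by linarith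
      qed
      let ?V = "(I \<inter> X) \<union> (Y - I)" and ?W = "(X - I) \<union> (I \<inter> Y)"
      \<comment> \<open>Since \<open>I\<close> avoids \<open>x\<close> and \<open>y\<close>, each
        half is a proper part and the induction hypothesis applies.\<close>
      have "x \<notin> ?V" "y \<notin> ?W" using xy I disj by auto
      then have ne: "?V \<noteq> X \<union> Y" "?W \<noteq> X \<union> Y" using xy by blast+
      obtain c :: "'a \<Rightarrow> nat" where c: "c ` ?V \<subseteq> {..<card (I \<inter> X)}"
        "\<forall>u\<in>?V. \<forall>v\<in>?V. u \<noteq> v \<longrightarrow> E u v \<longrightarrow> c u \<noteq> c v"
        using IH[of "I \<inter> X" "Y - I", OF _ _ ne(1) b1] by blast
      obtain d :: "'a \<Rightarrow> nat" where d: "d ` ?W \<subseteq> {..<card (I \<inter> Y)}"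
        "\<forall>u\<in>?W. \<forall>v\<in>?W. u \<noteq> v \<longrightarrow> E u v \<longrightarrow> d u \<noteq> d v"
        using IH[of "X - I" "I \<inter> Y", OF _ _ ne(2) b2] by blast
      \<comment> \<open>Shifting the second palette makes the two disjoint; by \<open>cardI\<close>
        they use \<open>k\<close> colours together.\<close>
      define e where "e = (\<lambda>u. if u \<in> ?V then c u else card (I \<inter> X) + d u)"
      have V: "e u = c u \<and> c u < card (I \<inter> X)" if "u \<in> ?V" for u
        using c(1) that unfolding e_def by auto
      have W: "e u = card (I \<inter> X) + d u \<and> d u < card (I \<inter> Y) \<and> u \<in> ?W"
        if "u \<in> X \<union> Y" "u \<notin> ?V" for u
      proof -
        have "u \<in> ?W" using that by blast
        then show ?thesis using d(1) that(2) unfolding e_def by auto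
      qed
      have "e u < k" if "u \<in> X \<union> Y" for u
        using V[of u] W[OF that] cardI by linarith
      moreover have "e u \<noteq> e v" if "u \<in> X \<union> Y" "v \<in> X \<union> Y" "u \<noteq> v" "E u v" for u v
        using V[of u] V[of v] W[of u] W[of v] c(2) d(2) that
        by (metis add_left_imp_eq not_add_less1)
      ultimately show ?thesis by (intro exI[of _ e]) blast
    qed
  qed
qed

section \<open>Induced subgraphs and passage to the complement\<close>

text \<open>An isomorphism also has to map arcs. Without parallel arcs an arc is determined by its
  ends, so an injection of vertices that preserves and reflects adjacency already fixes the arc
  map.\<close>

lemma not_free_of_embedding:
  assumes "wf_digraph G" "nomulti_digraph G" "wf_digraph F" "nomulti_digraph F"
    and inj: "inj_on \<phi> (verts F)" and img: "\<phi> ` verts F \<subseteq> verts G"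
    and adj: "\<And>u v. \<lbrakk>u \<in> verts F; v \<in> verts F\<rbrakk> \<Longrightarrow> \<phi> u \<rightarrow>\<^bsub>G\<^esub> \<phi> v \<longleftrightarrow> u \<rightarrow>\<^bsub>F\<^esub> v"
  shows "\<not> free_of F G"
proof -
  interpret G: wf_digraph G by fact
  interpret Gm: nomulti_digraph G by fact
  interpret F: wf_digraph F by fact
  interpret Fm: nomulti_digraph F by fact
  define H where "H = G \<restriction> \<phi> ` verts F"
  have ind: "induced_subgraph H G"
    using img unfolding H_def by (rule G.induced_induce)
  interpret H: wf_digraph H using ind by auto
  have H: "verts H = \<phi> ` verts F" "tail H = tail G" "head H = head G"
    "arcs H = {e \<in> arcs G. tail G e \<in> \<phi> ` verts F \<and> head G e \<in> \<phi> ` verts F}"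
    by (auto simp: H_def)
  define \<psi> where "\<psi> = the_inv_into (verts F) \<phi>"
  have \<psi>: "\<psi> (\<phi> u) = u" if "u \<in> verts F" for u
    using inj that by (simp add: \<psi>_def the_inv_into_f_f)
  define P where "P e b \<longleftrightarrow> b \<in> arcs F \<and> \<phi> (tail F b) = tail G e \<and> \<phi> (head F b) = head G e" for e b
  have ex: "\<exists>b. P e b" if e: "e \<in> arcs H" for e
  proof -
    obtain u v where uv: "u \<in> verts F" "v \<in> verts F" "tail G e = \<phi> u" "head G e = \<phi> v" "e \<in> arcs G"
      using e unfolding H by blast
    then have "u \<rightarrow>\<^bsub>F\<^esub> v"
      using adj[of u v] by (metis G.in_arcs_imp_in_arcs_ends)
    then show ?thesis using uv by (auto simp: P_def arcs_ends_conv)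
  qed
  have ex': "\<exists>e\<in>arcs H. P e b" if "b \<in> arcs F" for b
  proof -
    have "\<phi> (tail F b) \<rightarrow>\<^bsub>G\<^esub> \<phi> (head F b)"
      using adj that by (metis F.in_arcs_imp_in_arcs_ends F.tail_in_verts F.head_in_verts)
    then obtain e where e: "e \<in> arcs G" "tail G e = \<phi> (tail F b)" "head G e = \<phi> (head F b)"
      by (auto simp: arcs_ends_conv)
    then have "e \<in> arcs H" using that by (simp add: H)
    then show ?thesis using e that unfolding P_def by (intro bexI[of _ e]) simp_all
  qed
  have unique: "b = b'" if "P e b" "P e b'" for e b b'
  proof -
    have "tail F b = tail F b'" "head F b = head F b'"
      using that inj unfolding P_def by (metis F.tail_in_verts F.head_in_verts inj_onD)+
    then show ?thesis using that by (intro Fm.no_multi_arcs) (auto simp: P_def arc_to_ends_def)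
  qed
  have unique': "e = e'" if "e \<in> arcs H" "e' \<in> arcs H" "P e b" "P e' b" for e e' b
    using that unfolding P_def H by (intro Gm.no_multi_arcs) (auto simp: arc_to_ends_def)
  define \<alpha> where "\<alpha> e = (THE b. P e b)" for e
  have \<alpha>: "P e (\<alpha> e)" if "e \<in> arcs H" for e
    unfolding \<alpha>_def using ex[OF that] unique by (metis theI)
  \<comment> \<open>The isomorphism runs from \<open>H\<close> to \<open>F\<close>, so its vertex
    map is the inverse \<psi> of \<phi>.\<close>
  define f where "f = \<lparr>iso_verts = \<psi>, iso_arcs = \<alpha>, iso_head = head F, iso_tail = tail F\<rparr>"
  have "H.digraph_isomorphism f"
    unfolding H.digraph_isomorphism_def
  proof (intro conjI ballI)
    show "wf_digraph H" ..
    show "inj_on (iso_verts f) (verts H)"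
      using \<psi> by (auto simp: f_def H inj_on_def)
    show "inj_on (iso_arcs f) (arcs H)"
      using unique' \<alpha> by (auto simp: f_def inj_on_def) metis
    fix a assume "a \<in> arcs H"
    then have "P a (\<alpha> a)" by (rule \<alpha>)
    then show "iso_verts f (tail H a) = iso_tail f (iso_arcs f a)"
      and "iso_verts f (head H a) = iso_head f (iso_arcs f a)"
      unfolding P_def f_def H by (metis \<psi> F.tail_in_verts F.head_in_verts
          digraph_isomorphism.select_convs)+
  qed
  moreover have "F = app_iso f H"
  proof (rule pre_digraph.equality)
    show "verts F = verts (app_iso f H)"
      using \<psi> by (force simp: f_def H)
    show "arcs F = arcs (app_iso f H)"
    proof -
      have "\<alpha> e \<in> arcs F" if "e \<in> arcs H" for e using \<alpha>[OF that] by (simp add: P_def)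
      moreover have "b \<in> \<alpha> ` arcs H" if "b \<in> arcs F" for b
        using ex'[OF that] \<alpha> unique by blast
      ultimately show ?thesis by (auto simp: f_def)
    qed
  qed (auto simp: f_def)
  ultimately show ?thesis using ind by (auto simp: free_of_def digraph_iso_def)
qed

lemma induced_subgraph_dominates_iff:
  assumes "induced_subgraph H G"
  shows "u \<rightarrow>\<^bsub>H\<^esub> v \<longleftrightarrow> u \<in> verts H \<and> v \<in> verts H \<and> u \<rightarrow>\<^bsub>G\<^esub> v"
proof -
  interpret H: wf_digraph H using assms by auto
  have "tail H = tail G" "head H = head G"
    "arcs H = {e \<in> arcs G. tail G e \<in> verts H \<and> head G e \<in> verts H}"
    using assms unfolding induced_subgraph_def subgraph_def compatible_def by metis+
  then show ?thesis by (auto simp: arcs_ends_conv)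
qed

lemma graph_induced_subgraph:
  assumes "graph G" "induced_subgraph H G"
  shows "graph H"
proof -
  interpret G: graph G by fact
  interpret H: digraph H using assms(2) by (rule G.digraphI_induced)
  interpret H: sym_digraph H using assms(2) by (rule G.induced_graph_imp_graph)
  show ?thesis by unfold_locales
qed

text \<open>Adjacency in the complement, as a bare relation to which \<open>bull_K4_free\<close> can
  be applied; membership in \<open>verts G\<close> makes its neighbourhoods sets of
  vertices.\<close>

definition nonadjacent :: "('a, 'b) pre_digraph \<Rightarrow> 'a \<Rightarrow> 'a \<Rightarrow> bool" where
  "nonadjacent G u v \<longleftrightarrow> u \<in> verts G \<and> v \<in> verts G \<and> u \<noteq> v \<and> \<not> u \<rightarrow>\<^bsub>G\<^esub> v"

lemma (in graph) dominates_sym: "u \<rightarrow>\<^bsub>G\<^esub> v \<longleftrightarrow> v \<rightarrow>\<^bsub>G\<^esub> u"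
  using symmetric_conv sym_arcs by (meson symD symmetric_def)

lemma (in graph) dominates_irrefl: "\<not> u \<rightarrow>\<^bsub>G\<^esub> u"
  using adj_not_same by blast

text \<open>The bull is self-complementary: in the complement \<open>d e c\<close> is the triangle, with pendant
  edges \<open>d b\<close> and \<open>e a\<close>.\<close>

lemma nonadjacent_bull_K4_free:
  assumes "graph G" "free_of bull G" "free_of (edgeless 4) G"
  shows "bull_K4_free (nonadjacent G)"
proof -
  interpret graph G by fact
  interpret b: graph bull by (rule graph_bull)
  interpret s: graph "edgeless 4" by (rule graph_edgeless)
  show ?thesis
  proof
    show "nonadjacent G y x" if "nonadjacent G x y" for x y
      using that dominates_sym by (auto simp: nonadjacent_def)
    show "\<not> nonadjacent G x x" for x by (simp add: nonadjacent_def)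
    show "\<not> (nonadjacent G a b \<and> nonadjacent G a c \<and> nonadjacent G a d \<and>
        nonadjacent G b c \<and> nonadjacent G b d \<and> nonadjacent G c d)" for a b c d
    proof
      let ?f = "\<lambda>i. [a, b, c, d] ! i"
      assume *: "nonadjacent G a b \<and> nonadjacent G a c \<and> nonadjacent G a d \<and>
        nonadjacent G b c \<and> nonadjacent G b d \<and> nonadjacent G c d"
      have V: "verts (edgeless 4) = {0, 1, 2, 3}" "\<not> u \<rightarrow>\<^bsub>edgeless 4\<^esub> v" for u v
        by (auto simp: edgeless_def arcs_ends_conv)
      have "\<not> free_of (edgeless 4) G"
      proof (rule not_free_of_embedding)
        show "inj_on ?f (verts (edgeless 4))" "?f ` verts (edgeless 4) \<subseteq> verts G"
          using * by (auto simp: V nonadjacent_def)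
        show "?f u \<rightarrow>\<^bsub>G\<^esub> ?f v \<longleftrightarrow> u \<rightarrow>\<^bsub>edgeless 4\<^esub> v"
          if "u \<in> verts (edgeless 4)" "v \<in> verts (edgeless 4)" for u v
          using that * dominates_irrefl dominates_sym by (auto simp: V nonadjacent_def)
      qed unfold_locales
      then show False using assms by simp
    qed
    show "\<not> (nonadjacent G a b \<and> nonadjacent G b c \<and> nonadjacent G a c \<and> nonadjacent G a d \<and>
        nonadjacent G b e \<and> \<not> nonadjacent G a e \<and> \<not> nonadjacent G b d \<and> \<not> nonadjacent G c d \<and>
        \<not> nonadjacent G c e \<and> \<not> nonadjacent G d e)" for a b c d e
    proof
      let ?f = "\<lambda>i. [d, e, c, b, a] ! i"
      assume *: "nonadjacent G a b \<and> nonadjacent G b c \<and> nonadjacent G a c \<and> nonadjacent G a d \<and>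
        nonadjacent G b e \<and> \<not> nonadjacent G a e \<and> \<not> nonadjacent G b d \<and> \<not> nonadjacent G c d \<and>
        \<not> nonadjacent G c e \<and> \<not> nonadjacent G d e"
      \<comment> \<open>A negated \<open>nonadjacent\<close> also admits equal vertices, so
        distinctness has to come first before the negations can be read as edges of
        \<open>G\<close>.\<close>
      then have distinct: "distinct [d, e, c, b, a]"
        using dominates_sym by (auto simp: nonadjacent_def)
      have verts: "{a, b, c, d, e} \<subseteq> verts G" using * by (auto simp: nonadjacent_def)
      have edges: "d \<rightarrow>\<^bsub>G\<^esub> e" "e \<rightarrow>\<^bsub>G\<^esub> c" "d \<rightarrow>\<^bsub>G\<^esub> c" "d \<rightarrow>\<^bsub>G\<^esub> b" "e \<rightarrow>\<^bsub>G\<^esub> a"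
        "\<not> c \<rightarrow>\<^bsub>G\<^esub> b" "\<not> c \<rightarrow>\<^bsub>G\<^esub> a" "\<not> b \<rightarrow>\<^bsub>G\<^esub> a" "\<not> d \<rightarrow>\<^bsub>G\<^esub> a" "\<not> e \<rightarrow>\<^bsub>G\<^esub> b"
        using * distinct verts dominates_sym by (auto simp: nonadjacent_def)
      have edges_rev: "e \<rightarrow>\<^bsub>G\<^esub> d" "c \<rightarrow>\<^bsub>G\<^esub> e" "c \<rightarrow>\<^bsub>G\<^esub> d" "b \<rightarrow>\<^bsub>G\<^esub> d" "a \<rightarrow>\<^bsub>G\<^esub> e"
        "\<not> b \<rightarrow>\<^bsub>G\<^esub> c" "\<not> a \<rightarrow>\<^bsub>G\<^esub> c" "\<not> a \<rightarrow>\<^bsub>G\<^esub> b" "\<not> a \<rightarrow>\<^bsub>G\<^esub> d" "\<not> b \<rightarrow>\<^bsub>G\<^esub> e"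
        using edges dominates_sym by blast+
      have V: "verts bull = {0, 1, 2, 3, 4}"
        "u \<rightarrow>\<^bsub>bull\<^esub> v \<longleftrightarrow> (u, v) \<in> {(0, 1), (1, 2), (0, 2), (0, 3), (1, 4)} \<or>
          (v, u) \<in> {(0, 1), (1, 2), (0, 2), (0, 3), (1, 4)}" for u v
        by (auto simp: bull_def arcs_ends_conv Let_def image_iff)
      have "\<not> free_of bull G"
      proof (rule not_free_of_embedding)
        show "inj_on ?f (verts bull)" "?f ` verts bull \<subseteq> verts G"
          using distinct verts by (auto simp: V)
        show "?f u \<rightarrow>\<^bsub>G\<^esub> ?f v \<longleftrightarrow> u \<rightarrow>\<^bsub>bull\<^esub> v" if "u \<in> verts bull" "v \<in> verts bull" for u v
          using that unfolding V
          by (elim insertE emptyE) (simp_all add: edges edges_rev dominates_irrefl)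
      qed unfold_locales
      then show False using assms by simp
    qed
  qed
qed

section \<open>Clique numbers, colourings and perfect parts\<close>

lemma finite_cliques: "finite (verts G) \<Longrightarrow> finite {K. is_clique G K}"
  by (rule finite_subset[of _ "Pow (verts G)"]) (auto simp: is_clique_def)

lemma card_clique_le: "\<lbrakk>finite (verts G); is_clique G K\<rbrakk> \<Longrightarrow> card K \<le> clique_number G"
  unfolding clique_number_def by (intro Max_ge finite_imageI finite_cliques) auto

text \<open>Any proper colouring is injective on a maximum clique, so only the upper bound has to be
  supplied.\<close>

lemma chromatic_number_eq_clique_number:
  assumes "finite (verts G)" "proper_coloring G (clique_number G) c"
  shows "chromatic_number G = clique_number G"
  unfolding chromatic_number_def
proof (rule Least_equality)
  show "\<exists>c. proper_coloring G (clique_number G) c" using assms by blast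
  fix k assume "\<exists>c. proper_coloring G k c"
  then obtain d where d: "proper_coloring G k d" by blast
  have "is_clique G {}" by (simp add: is_clique_def)
  then have "clique_number G \<in> card ` {K. is_clique G K}"
    unfolding clique_number_def using finite_cliques[OF assms(1)] by (intro Max_in) auto
  then obtain K where K: "is_clique G K" "card K = clique_number G" by auto
  have "inj_on d K" "d ` K \<subseteq> {..<k}"
    using K d unfolding inj_on_def proper_coloring_def is_clique_def by blast+
  then show "clique_number G \<le> k"
    using K(2) by (metis card_inj_on_le card_lessThan finite_lessThan)
qed

text \<open>The hypotheses pass to induced subgraphs, so it suffices to colour each with as many
  colours as its clique number. The isolated \<open>v\<close> may reuse colour 0, which is available
  because a single vertex is a clique.\<close>

lemma perfect_isolated_vertex_cobipartite:
  assumes "graph G" "verts G \<subseteq> insert v (X \<union> Y)" "X \<inter> Y = {}"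
    and X: "\<And>x x'. \<lbrakk>x \<in> X; x' \<in> X; x \<noteq> x'\<rbrakk> \<Longrightarrow> x \<rightarrow>\<^bsub>G\<^esub> x'"
    and Y: "\<And>y y'. \<lbrakk>y \<in> Y; y' \<in> Y; y \<noteq> y'\<rbrakk> \<Longrightarrow> y \<rightarrow>\<^bsub>G\<^esub> y'"
    and v: "\<And>x. \<not> v \<rightarrow>\<^bsub>G\<^esub> x"
  shows "perfect_graph G"
  unfolding perfect_graph_def
proof (intro allI impI)
  fix H assume H: "induced_subgraph H G"
  interpret G: graph G by fact
  interpret H: graph H using graph_induced_subgraph[OF \<open>graph G\<close> H] .
  note adj = induced_subgraph_dominates_iff[OF H]
  have V: "verts H \<subseteq> insert v (X \<union> Y)"
    using H assms(2) by (auto simp: induced_subgraph_def subgraph_def)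
  define X' Y' where "X' = X \<inter> verts H" and "Y' = Y \<inter> verts H"
  have "\<exists>c :: 'a \<Rightarrow> nat. c ` (X' \<union> Y') \<subseteq> {..<clique_number H} \<and>
    (\<forall>x\<in>X' \<union> Y'. \<forall>y\<in>X' \<union> Y'. x \<noteq> y \<longrightarrow> x \<rightarrow>\<^bsub>H\<^esub> y \<longrightarrow> c x \<noteq> c y)"
  proof (rule cobipartite_colouring)
    show "finite X'" "finite Y'" "X' \<inter> Y' = {}"
      using H.finite_verts assms(3) by (auto simp: X'_def Y'_def)
    show "y \<rightarrow>\<^bsub>H\<^esub> x" if "x \<rightarrow>\<^bsub>H\<^esub> y" for x y using that H.dominates_sym by blast
    show "\<forall>x\<in>X'. \<forall>x'\<in>X'. x \<noteq> x' \<longrightarrow> x \<rightarrow>\<^bsub>H\<^esub> x'" "\<forall>x\<in>Y'. \<forall>x'\<in>Y'. x \<noteq> x' \<longrightarrow> x \<rightarrow>\<^bsub>H\<^esub> x'"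
      using X Y by (auto simp: X'_def Y'_def adj)
    show "card K \<le> clique_number H"
      if "K \<subseteq> X' \<union> Y'" "\<forall>x\<in>K. \<forall>y\<in>K. x \<noteq> y \<longrightarrow> x \<rightarrow>\<^bsub>H\<^esub> y" for K
      using that by (intro card_clique_le) (auto simp: is_clique_def X'_def Y'_def)
  qed
  then obtain c :: "'a \<Rightarrow> nat" where c: "c ` (X' \<union> Y') \<subseteq> {..<clique_number H}"
    "\<And>x y. \<lbrakk>x \<in> X' \<union> Y'; y \<in> X' \<union> Y'; x \<noteq> y; x \<rightarrow>\<^bsub>H\<^esub> y\<rbrakk> \<Longrightarrow> c x \<noteq> c y"
    by blast
  have "proper_coloring H (clique_number H) (c(v := 0))"
    unfolding proper_coloring_def
  proof (intro conjI ballI impI)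
    have "0 < clique_number H" if "u \<in> verts H" for u
      using card_clique_le[of H "{u}"] that by (simp add: is_clique_def)
    moreover have "c u < clique_number H" if "u \<in> verts H" "u \<noteq> v" for u
      using c(1) V that by (auto simp: X'_def Y'_def)
    ultimately show "(c(v := 0)) ` verts H \<subseteq> {..<clique_number H}" by auto
    fix x y assume xy: "x \<in> verts H" "y \<in> verts H" "x \<rightarrow>\<^bsub>H\<^esub> y"
    then have "x \<noteq> v" "y \<noteq> v" "x \<noteq> y"
      using v adj H.dominates_sym H.dominates_irrefl by blast+
    then show "(c(v := 0)) x \<noteq> (c(v := 0)) y"
      using c(2)[of x y] V xy by (auto simp: X'_def Y'_def)
  qed
  then show "chromatic_number H = clique_number H"
    by (rule chromatic_number_eq_clique_number[rotated]) simp
qed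

text \<open>The two stable sets of the complement are cliques of \<open>G\<close>, and
  \<open>u\<close> is isolated from its non-neighbours.\<close>

lemma ex_perfect_nonneighbourhood:
  assumes "graph G" "bull_K4_free (nonadjacent G)" "verts G \<noteq> {}"
  shows "\<exists>u\<in>verts G. perfect_graph (G \<restriction> insert u {x. nonadjacent G u x})"
proof -
  interpret graph G by fact
  interpret E: bull_K4_free "nonadjacent G" by fact
  obtain u A where u: "u \<in> verts G" and A: "A \<subseteq> {x. nonadjacent G u x}"
    "\<forall>x\<in>A. \<forall>y\<in>A. \<not> nonadjacent G x y"
    "\<forall>x\<in>{x. nonadjacent G u x} - A. \<forall>y\<in>{x. nonadjacent G u x} - A. \<not> nonadjacent G x y"
    using E.ex_bipartite_neighbourhood assms(3) unfolding bipartite_on_def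
    by (metis nonadjacent_def ex_in_conv)
  let ?P = "insert u {x. nonadjacent G u x}"
  have P: "?P \<subseteq> verts G" using u by (auto simp: nonadjacent_def)
  have ind: "induced_subgraph (G \<restriction> ?P) G" using P by (rule induced_induce)
  have nonadjacent_or_dominates: "x \<rightarrow>\<^bsub>G \<restriction> ?P\<^esub> y" if "x \<in> ?P" "y \<in> ?P" "x \<noteq> y" "\<not> nonadjacent G x y" for x y
  proof -
    have "x \<in> verts G" "y \<in> verts G" using that(1,2) P by blast+
    then have "x \<rightarrow>\<^bsub>G\<^esub> y" using that(3,4) by (simp add: nonadjacent_def)
    then show ?thesis using that(1,2) unfolding induced_subgraph_dominates_iff[OF ind] by simp
  qed
  have "perfect_graph (G \<restriction> ?P)"
  proof (rule perfect_isolated_vertex_cobipartite)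
    show "graph (G \<restriction> ?P)" using graph_induced_subgraph ind \<open>graph G\<close> by blast
    show "verts (G \<restriction> ?P) \<subseteq> insert u (A \<union> ({x. nonadjacent G u x} - A))" by auto
    show "x \<rightarrow>\<^bsub>G \<restriction> ?P\<^esub> y" if "x \<in> A" "y \<in> A" "x \<noteq> y" for x y
      using nonadjacent_or_dominates[of x y] that A by blast
    show "x \<rightarrow>\<^bsub>G \<restriction> ?P\<^esub> y" if "x \<in> {x. nonadjacent G u x} - A" "y \<in> {x. nonadjacent G u x} - A"
      "x \<noteq> y" for x y
      using nonadjacent_or_dominates[of x y] that A by blast
    show "\<not> u \<rightarrow>\<^bsub>G \<restriction> ?P\<^esub> x" for x
      unfolding induced_subgraph_dominates_iff[OF ind]
      using dominates_irrefl by (auto simp: nonadjacent_def)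
  qed auto
  then show ?thesis using u by blast
qed

lemma weighted_clique_number_neighbourhood_less:
  assumes "graph G" "u \<in> verts G" "0 < w u" "W \<subseteq> verts G" "u \<notin> W"
    and dom: "\<And>x. x \<in> W \<Longrightarrow> u \<rightarrow>\<^bsub>G\<^esub> x"
  shows "weighted_clique_number w (G \<restriction> W) < weighted_clique_number w G"
proof -
  interpret graph G by fact
  have ind: "induced_subgraph (G \<restriction> W) G" using \<open>W \<subseteq> verts G\<close> by (rule induced_induce)
  have "finite W" using \<open>W \<subseteq> verts G\<close> finite_verts finite_subset by blast
  then have "weighted_clique_number w (G \<restriction> W) \<in> sum w ` {K. is_clique (G \<restriction> W) K}"
    unfolding weighted_clique_number_def
    \<comment> \<open>The empty clique shows that the maximum is attained, even for empty
      \<open>W\<close>.\<close>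
    by (intro Max_in finite_imageI finite_cliques) (auto simp: is_clique_def intro!: exI[of _ "{}"])
  then obtain K where K: "is_clique (G \<restriction> W) K" "sum w K = weighted_clique_number w (G \<restriction> W)"
    by auto
  have "K \<subseteq> W" using K by (simp add: is_clique_def)
  then have "is_clique G (insert u K)"
    using K(1) assms(2,4) dom dominates_sym
    by (auto simp: is_clique_def induced_subgraph_dominates_iff[OF ind])
  then have "sum w (insert u K) \<le> weighted_clique_number w G"
    unfolding weighted_clique_number_def
    by (intro Max_ge finite_imageI finite_cliques) auto
  moreover have "sum w (insert u K) = w u + sum w K"
    using \<open>K \<subseteq> W\<close> \<open>finite W\<close> \<open>u \<notin> W\<close> finite_subset by (subst sum.insert) auto
  ultimately show ?thesis using K(2) \<open>0 < w u\<close> by linarith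
qed

text \<open>Since \<open>H\<close> is induced, \<open>nonadjacent H\<close> restricts
  \<open>nonadjacent G\<close> to \<open>verts H\<close>, and a forbidden configuration in it is one
  in \<open>G\<close>. Hence the forbidden subgraphs are examined only once, in
  \<open>G\<close>.\<close>

lemma bull_K4_free_restrict:
  assumes "bull_K4_free (nonadjacent G)" "induced_subgraph H G"
  shows "bull_K4_free (nonadjacent H)"
proof -
  interpret bull_K4_free "nonadjacent G" by fact
  have "verts H \<subseteq> verts G" using assms(2) by (auto simp: induced_subgraph_def subgraph_def)
  then have E: "nonadjacent H x y \<longleftrightarrow> x \<in> verts H \<and> y \<in> verts H \<and> nonadjacent G x y" for x y
    by (auto simp: nonadjacent_def induced_subgraph_dominates_iff[OF assms(2)])
  show ?thesis
    by unfold_locales (use sym irrefl no_K4 no_bull in \<open>unfold E, blast+\<close>)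
qed

text \<open>Unit weights turn the weight of a clique into its size.\<close>

lemma perfectly_weight_divisible_imp_perfectly_divisible:
  assumes "perfectly_weight_divisible G"
  shows "perfectly_divisible G"
proof -
  have "weighted_clique_number (\<lambda>_. 1) = (clique_number :: ('a, 'b) pre_digraph \<Rightarrow> nat)"
    by (simp add: fun_eq_iff weighted_clique_number_def clique_number_def)
  then show ?thesis
    using assms[unfolded perfectly_weight_divisible_def, THEN spec[of _ "\<lambda>_. 1"]]
    by (simp add: perfectly_divisible_def)
qed

theorem theorem4:
  fixes G :: "('a, 'b) pre_digraph"
  assumes "graph G"
    and "free_of bull G"
    and "free_of (edgeless 4) G"
  shows "perfectly_weight_divisible G \<and> perfectly_divisible G"
proof -
  have "perfectly_weight_divisible G"
    unfolding perfectly_weight_divisible_def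
  proof (intro allI impI)
    fix w :: "'a \<Rightarrow> nat" and H :: "('a, 'b) pre_digraph"
    assume w: "\<forall>v\<in>verts G. 0 < w v" and "induced_subgraph H G \<and> verts H \<noteq> {}"
    then have H: "induced_subgraph H G" "verts H \<noteq> {}" by auto
    interpret H: graph H using graph_induced_subgraph \<open>graph G\<close> H(1) .
    obtain u where u: "u \<in> verts H" "perfect_graph (H \<restriction> insert u {x. nonadjacent H u x})"
      using ex_perfect_nonneighbourhood[OF H.graph_axioms] H
        bull_K4_free_restrict[OF nonadjacent_bull_K4_free[OF assms] H(1)] by blast
    let ?P = "insert u {x. nonadjacent H u x}"
    have "verts H \<subseteq> verts G" using H(1) by (simp add: induced_subgraph_def subgraph_def)
    then have "0 < w u" using u(1) w by blast
    \<comment> \<open>Outside \<open>?P\<close> only the neighbours of \<open>u\<close> in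
      \<open>H\<close> remain.\<close>
    then have "weighted_clique_number w (H \<restriction> (verts H - ?P)) < weighted_clique_number w H"
      using u(1) by (intro weighted_clique_number_neighbourhood_less[of _ u] H.graph_axioms)
        (auto simp: nonadjacent_def)
    moreover have "?P \<subseteq> verts H" using u(1) by (auto simp: nonadjacent_def)
    ultimately show "\<exists>P W. P \<union> W = verts H \<and> P \<inter> W = {} \<and> perfect_graph (H \<restriction> P) \<and>
        weighted_clique_number w (H \<restriction> W) < weighted_clique_number w H"
      using u(2) by (intro exI[of _ ?P] exI[of _ "verts H - ?P"]) auto
  qed
  then show ?thesis by (simp add: perfectly_weight_divisible_imp_perfectly_divisible)
qed

end
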